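(* Let $\mathcal{U}\subseteq\mathbb{R}^m$ be compact, let $X\subseteq\mathbb{R}^n$ be compact, and let $f,g:X\times\mathcal{U}\to\mathbb{R}$ be continuous in $(x,u)\in X\times\mathcal{U}$. Let $\mathcal{W}\subseteq 2^{\mathcal{U}}$ be a cover space and $V:\mathcal{W}\to\mathbb{R}$ a merit function such that: (A1) for every $W\in\mathcal{W}$, the closure $\overline{W}$ belongs to $\mathcal{W}$; (A2) for every compact $C\subseteq\mathcal{U}$, the set $\mathcal{K}(C)\cap\mathcal{W}$ is complete with respect to the Hausdorff metric $d_H$; (A3) $\{\bar u\}\in\mathcal{W}$; (B1) the restriction of $V$ to $\tilde{\mathcal{W}}:=\mathcal{K}(\mathcal{U})\cap\mathcal{W}$ is upper semi-continuous with respect to the topology induced by the Hausdorff metric; (B2) $V(W_1)\le V(W_2)$ for all $W_1,W_2\in\mathcal{W}$ with $W_1\subseteq W_2$. Then there exists a maximizer $(x^*,W^* )\in X\times\mathcal{W}$ of the inverse robust optimization problem $(\mathcal{P}_{\mathrm{IROP}})$ such that $W^*$ is a compact set.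
   Context: A nominal scenario $\bar u\in\mathcal{U}$ is fixed, and it is assumed that the nominal problem $f^*:=\min\{f(x,\bar u): x\in X,\ g(x,\bar u)\le 0\}$ has a feasible point and that the minimum $f^*$ is well defined (attained). A budget $\epsilon\ge 0$ is fixed. The inverse robust optimization problem $(\mathcal{P}_{\mathrm{IROP}})$ is: maximize $V(W)$ over all $(x,W)\in X\times\mathcal{W}$ subject to $f(x,u)\le f^*+\epsilon$ for all $u\in W$, $\ g(x,u)\le 0$ for all $u\in W$, and $\bar u\in W$. A maximizer is a feasible pair attaining the maximal value of $V(W)$ among feasible pairs. For compact $C\subseteq\mathcal{U}$, $\mathcal{K}(C)$ denotes the set of all compact subsets of $C$, equipped with the Hausdorff metric $d_H$ (if the empty set is included it is treated as an isolated point). Closures are taken in $\mathbb{R}^m$. *)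

theory Defs
  imports "HOL-Analysis.Analysis"
begin

text \<open>The value 0 on unbounded sets is a convention: the suprema are only meaningful, and the
  definition is only used, for bounded sets.\<close>
definition hausdorff_dist :: "'a::metric_space set \<Rightarrow> 'a set \<Rightarrow> real" where
  "hausdorff_dist A B =
     (if bounded A \<and> bounded B
      then max (SUP a\<in>A. infdist a B) (SUP b\<in>B. infdist b A) else 0)"

text \<open>The extension of the Hausdorff metric to all compact sets, the empty set included.  The value
  for one empty argument makes the empty set an isolated point (it has distance at least 1 from every
  nonempty set) and keeps the triangle inequality valid; see \<open>Metric_space_hausdorff\<close> below.\<close>
definition hausdorff_metric :: "'a::real_normed_vector set \<Rightarrow> 'a set \<Rightarrow> real" where
  "hausdorff_metric A B =
     (if A = {} \<and> B = {} then 0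
      else if B = {} then 1 + hausdorff_dist A {0}
      else if A = {} then 1 + hausdorff_dist B {0}
      else hausdorff_dist A B)"

definition compact_subsets :: "'a::topological_space set \<Rightarrow> 'a set set" where
  "compact_subsets C = {K. compact K \<and> K \<subseteq> C}"

definition upper_semicontinuous_map :: "'a topology \<Rightarrow> ('a \<Rightarrow> real) \<Rightarrow> bool" where
  "upper_semicontinuous_map T h \<longleftrightarrow> (\<forall>c. openin T {x \<in> topspace T. h x < c})"

definition nominal_feasible :: "'a set \<Rightarrow> ('a \<times> 'b \<Rightarrow> real) \<Rightarrow> 'b \<Rightarrow> 'a set" where
  "nominal_feasible X g ub = {x \<in> X. g (x, ub) \<le> 0}"

text \<open>The minimal value whenever a minimizer exists.\<close>
definition nominal_value ::
    "'a set \<Rightarrow> ('a \<times> 'b \<Rightarrow> real) \<Rightarrow> ('a \<times> 'b \<Rightarrow> real) \<Rightarrow> 'b \<Rightarrow> real" where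
  "nominal_value X f g ub = (INF x\<in>nominal_feasible X g ub. f (x, ub))"

definition irop_feasible ::
    "'a set \<Rightarrow> 'b set set \<Rightarrow> ('a \<times> 'b \<Rightarrow> real) \<Rightarrow> ('a \<times> 'b \<Rightarrow> real) \<Rightarrow> 'b \<Rightarrow> real
      \<Rightarrow> ('a \<times> 'b set) set" where
  "irop_feasible X \<W> f g ub \<epsilon> =
     {(x, W) \<in> X \<times> \<W>. (\<forall>u\<in>W. f (x, u) \<le> nominal_value X f g ub + \<epsilon>) \<and>
        (\<forall>u\<in>W. g (x, u) \<le> 0) \<and> ub \<in> W}"

definition irop_maximizer ::
    "'a set \<Rightarrow> 'b set set \<Rightarrow> ('b set \<Rightarrow> real) \<Rightarrow> ('a \<times> 'b \<Rightarrow> real) \<Rightarrow> ('a \<times> 'b \<Rightarrow> real)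
      \<Rightarrow> 'b \<Rightarrow> real \<Rightarrow> 'a \<times> 'b set \<Rightarrow> bool" where
  "irop_maximizer X \<W> V f g ub \<epsilon> =
     is_arg_max (\<lambda>(x, W). V W) (\<lambda>p. p \<in> irop_feasible X \<W> f g ub \<epsilon>)"

lemma hausdorff_dist_le_iff_bounded:
  fixes A B :: "'a::metric_space set"
  assumes "bounded A" "bounded B" "A \<noteq> {}" "B \<noteq> {}"
  shows "hausdorff_dist A B \<le> e \<longleftrightarrow> (\<forall>a\<in>A. infdist a B \<le> e) \<and> (\<forall>b\<in>B. infdist b A \<le> e)"
proof -
  have bdd: "bdd_above ((\<lambda>a. infdist a D) ` C)" if "bounded C" for C D :: "'a set"
  proof -
    obtain x r where r: "\<forall>y\<in>C. dist x y \<le> r"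
      using \<open>bounded C\<close> unfolding bounded_def by blast
    have "infdist y D \<le> infdist x D + r" if "y \<in> C" for y
      using infdist_triangle[of y D x] r that by (fastforce simp: dist_commute)
    then show ?thesis by (auto simp: bdd_above_def)
  qed
  show ?thesis
    using assms by (simp add: hausdorff_dist_def cSUP_le_iff bdd)
qed

lemma hausdorff_dist_le_iff:
  fixes A B :: "'a::metric_space set"
  assumes "compact A" "compact B" "A \<noteq> {}" "B \<noteq> {}"
  shows "hausdorff_dist A B \<le> e \<longleftrightarrow> (\<forall>a\<in>A. infdist a B \<le> e) \<and> (\<forall>b\<in>B. infdist b A \<le> e)"
  using assms by (intro hausdorff_dist_le_iff_bounded compact_imp_bounded)

lemma hausdorff_dist_commute: "hausdorff_dist A B = hausdorff_dist B A"
  by (simp add: hausdorff_dist_def max.commute conj_commute)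

lemma hausdorff_dist_nonneg:
  assumes "A \<noteq> {}" "B \<noteq> {}"
  shows "0 \<le> hausdorff_dist A B"
proof (cases "bounded A \<and> bounded B")
  case True
  obtain a where "a \<in> A" using assms by blast
  then have "infdist a B \<le> hausdorff_dist A B"
    using hausdorff_dist_le_iff_bounded[of A B "hausdorff_dist A B"] True assms by blast
  then show ?thesis using infdist_nonneg[of a B] by linarith
qed (auto simp: hausdorff_dist_def)

lemma hausdorff_dist_triangle:
  fixes A B C :: "'a::metric_space set"
  assumes "compact A" "compact B" "compact C" "A \<noteq> {}" "B \<noteq> {}" "C \<noteq> {}"
  shows "hausdorff_dist A C \<le> hausdorff_dist A B + hausdorff_dist B C"
proof -
  have half: "infdist p R \<le> hausdorff_dist P Q + hausdorff_dist Q R"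
    if "compact P" "compact Q" "compact R" "P \<noteq> {}" "Q \<noteq> {}" "R \<noteq> {}" "p \<in> P"
    for p :: 'a and P Q R
  proof -
    have "infdist p R - hausdorff_dist Q R \<le> dist p q" if "q \<in> Q" for q
    proof -
      have "infdist q R \<le> hausdorff_dist Q R"
        using hausdorff_dist_le_iff[of Q R "hausdorff_dist Q R"] \<open>q \<in> Q\<close>
          \<open>compact Q\<close> \<open>compact R\<close> \<open>R \<noteq> {}\<close> by auto
      then show ?thesis
        using infdist_triangle[of p R q] by linarith
    qed
    then have "infdist p R - hausdorff_dist Q R \<le> infdist p Q"
      using \<open>Q \<noteq> {}\<close> by (simp add: infdist_notempty cINF_greatest)
    moreover have "infdist p Q \<le> hausdorff_dist P Q"
      using hausdorff_dist_le_iff[of P Q "hausdorff_dist P Q"] that by auto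
    ultimately show ?thesis by linarith
  qed
  show ?thesis
    using half[of A B C] half[of C B A] assms
    by (auto simp: hausdorff_dist_le_iff hausdorff_dist_commute add.commute)
qed

lemma hausdorff_dist_eq_0_iff:
  fixes A B :: "'a::metric_space set"
  assumes "compact A" "compact B" "A \<noteq> {}" "B \<noteq> {}"
  shows "hausdorff_dist A B = 0 \<longleftrightarrow> A = B"
proof -
  have "hausdorff_dist A B = 0 \<longleftrightarrow> hausdorff_dist A B \<le> 0"
    using hausdorff_dist_nonneg[OF assms(3,4)] by linarith
  also have "\<dots> \<longleftrightarrow> (\<forall>a\<in>A. infdist a B = 0) \<and> (\<forall>b\<in>B. infdist b A = 0)"
    by (simp add: hausdorff_dist_le_iff[OF assms] antisym_conv infdist_nonneg)
  also have "\<dots> \<longleftrightarrow> (\<forall>a\<in>A. a \<in> B) \<and> (\<forall>b\<in>B. b \<in> A)"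
    using assms in_closed_iff_infdist_zero compact_imp_closed by metis
  finally show ?thesis by blast
qed

lemma Metric_space_hausdorff:
  "Metric_space {K :: 'a::real_normed_vector set. compact K} hausdorff_metric"
proof
  fix A B :: "'a set"
  show "0 \<le> hausdorff_metric A B"
    by (simp add: hausdorff_metric_def hausdorff_dist_nonneg)
  show "hausdorff_metric A B = hausdorff_metric B A"
    by (simp add: hausdorff_metric_def hausdorff_dist_commute)
next
  fix A B :: "'a set"
  assume "A \<in> {K. compact K}" "B \<in> {K. compact K}"
  then show "hausdorff_metric A B = 0 \<longleftrightarrow> A = B"
    using hausdorff_dist_nonneg[of A "{0}"] hausdorff_dist_nonneg[of B "{0}"]
    by (cases "A = {}"; cases "B = {}") (simp_all add: hausdorff_metric_def hausdorff_dist_eq_0_iff)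
next
  fix A B C :: "'a set"
  assume "A \<in> {K. compact K}" "B \<in> {K. compact K}" "C \<in> {K. compact K}"
  then have c: "compact A" "compact B" "compact C" by auto
  have z: "compact {0::'a}" by simp
  note nn = hausdorff_dist_nonneg[of A "{0}"] hausdorff_dist_nonneg[of B "{0}"]
    hausdorff_dist_nonneg[of C "{0}"]
  note tri = hausdorff_dist_triangle[OF c] hausdorff_dist_triangle[OF c(1) z c(3)]
    hausdorff_dist_triangle[OF c(1,2) z] hausdorff_dist_triangle[OF c(3,2) z]
  show "hausdorff_metric A C \<le> hausdorff_metric A B + hausdorff_metric B C"
    using nn tri hausdorff_dist_commute[of "{0}" C] hausdorff_dist_commute[of C B]
    by (cases "A = {}"; cases "B = {}"; cases "C = {}") (auto simp: hausdorff_metric_def)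
qed

lemma Metric_space_hausdorff_subset:
  "\<S> \<subseteq> {K :: 'a::real_normed_vector set. compact K} \<Longrightarrow> Metric_space \<S> hausdorff_metric"
  by (rule Metric_space.subspace[OF Metric_space_hausdorff])

end

theory Submission
  imports Defs
begin

text \<open>The compact subsets of a compact set form a totally bounded space under the Hausdorff metric
  (Blaschke), so by (A2) the compact cover sets form a compact metric space. Its feasible members, those
  \<open>W\<close> that admit a common \<open>x\<close>, form a closed subset, on which the upper semicontinuous \<open>V\<close> attains its
  maximum. An arbitrary feasible \<open>W\<close> may be replaced by its closure: continuity keeps it feasible, and
  monotonicity does not decrease \<open>V\<close>.\<close>

lemma infdist_le_hausdorff_dist:
  assumes "bounded A" "bounded B" "B \<noteq> {}" "a \<in> A"
  shows "infdist a B \<le> hausdorff_dist A B"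
  using hausdorff_dist_le_iff_bounded[of A B "hausdorff_dist A B"] assms by auto

lemma hausdorff_metric_empty_ge_1:
  assumes "A \<noteq> {}"
  shows "hausdorff_metric A {} \<ge> 1"
  using assms by (simp add: hausdorff_metric_def hausdorff_dist_nonneg)

text \<open>A finite \<open>e/2\<close>-net \<open>F\<close> of \<open>C\<close> yields the finite
  net \<open>Pow F\<close> of compact sets: \<open>K\<close> is approximated by the points of
  \<open>F\<close> that lie within \<open>e/2\<close> of it. The bound \<open>e/2\<close> on the
  suprema leaves room for the strict inequality of an open ball of radius \<open>e\<close>.\<close>

lemma mtotally_bounded_compact_subsets:
  fixes C :: "'a::real_normed_vector set"
  assumes "compact C"
  shows "Metric_space.mtotally_bounded {K. compact K} hausdorff_metric (compact_subsets C)"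
  unfolding Metric_space.mtotally_bounded_def[OF Metric_space_hausdorff]
proof (intro allI impI)
  fix e :: real
  assume e: "e > 0"
  obtain F where F: "finite F" "F \<subseteq> C" "C \<subseteq> (\<Union>x\<in>F. ball x (e/2))"
    using compact_imp_seq_compact[OF assms] seq_compact_imp_totally_bounded[of C] e
    by (meson half_gt_zero)
  have FC: "Pow F \<subseteq> compact_subsets C"
    using F(1,2) by (auto simp: compact_subsets_def intro: finite_subset finite_imp_compact)
  have "\<exists>P\<in>Pow F. K \<in> Metric_space.mball {K. compact K} hausdorff_metric P e"
    if K: "K \<in> compact_subsets C" for K
  proof -
    define P where "P = {p\<in>F. \<exists>k\<in>K. dist p k < e/2}"
    have cK: "compact K" and KC: "K \<subseteq> C" using K by (auto simp: compact_subsets_def)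
    have cP: "compact P" using F(1) by (simp add: P_def finite_imp_compact)
    have near: "\<exists>p\<in>P. dist k p < e/2" if "k \<in> K" for k
      using F(3) KC that unfolding P_def by (fastforce simp: dist_commute)
    have "hausdorff_metric P K \<le> e/2"
    \<comment> \<open>For empty \<open>K\<close> the set \<open>P\<close> is empty as well, so the
      isolated point is its own centre in \<open>Pow F\<close>.\<close>
    proof (cases "K = {}")
      case True
      then show ?thesis using e by (simp add: P_def hausdorff_metric_def)
    next
      case False
      then have "P \<noteq> {}" using near by blast
      moreover have "infdist p K \<le> e/2" if "p \<in> P" for p
        using that infdist_le2 less_imp_le unfolding P_def by blast
      moreover have "infdist k P \<le> e/2" if "k \<in> K" for k
        using near[OF that] infdist_le2 less_imp_le by blast
      ultimately show ?thesis
        using False hausdorff_dist_le_iff[OF cP cK, of "e/2"] by (simp add: hausdorff_metric_def)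
    qed
    then show ?thesis
      using e cK cP
      by (intro bexI[of _ P]) (auto simp: Metric_space.in_mball[OF Metric_space_hausdorff] P_def)
  qed
  then show "\<exists>\<F>. finite \<F> \<and> \<F> \<subseteq> compact_subsets C \<and>
      compact_subsets C \<subseteq> (\<Union>P\<in>\<F>. Metric_space.mball {K. compact K} hausdorff_metric P e)"
    using F(1) FC by (intro exI[of _ "Pow F"]) blast
qed

text \<open>Total boundedness passes to subsets and does not depend on the ambient space; together
  with completeness it gives compactness.\<close>

lemma compact_space_hausdorff:
  fixes C :: "'a::real_normed_vector set"
  assumes "compact C" and sub: "\<S> \<subseteq> compact_subsets C"
    and "Metric_space.mcomplete \<S> hausdorff_metric"
  shows "compact_space (Metric_space.mtopology \<S> hausdorff_metric)"
proof -
  have S: "\<S> \<subseteq> {K. compact K}"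
    using sub by (auto simp: compact_subsets_def)
  have "Metric_space.mtotally_bounded {K. compact K} hausdorff_metric \<S>"
    using Metric_space.mtotally_bounded_subset[OF Metric_space_hausdorff
        mtotally_bounded_compact_subsets[OF assms(1)] sub] .
  then have "Metric_space.mtotally_bounded \<S> hausdorff_metric \<S>"
    using Metric_space.mtotally_bounded_submetric[OF Metric_space_hausdorff] S by blast
  then show ?thesis
    using Metric_space.compact_space_eq_mcomplete_mtotally_bounded
      Metric_space_hausdorff_subset[OF S] assms(3) by blast
qed

text \<open>Without a maximum, the open sets \<open>{h < h a}\<close> with \<open>a\<close> in
  \<open>M\<close> would cover \<open>M\<close>. In a finite subcover, the centre with the largest
  value of \<open>h\<close> is covered by none of them.\<close>

lemma upper_semicontinuous_map_attains_max:
  assumes usc: "upper_semicontinuous_map T h" and comp: "compactin T M" and ne: "M \<noteq> {}"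
  obtains a where "a \<in> M" "\<And>b. b \<in> M \<Longrightarrow> h b \<le> h a"
proof -
  define B where "B = (\<lambda>a. {x \<in> topspace T. h x < h a})"
  have "\<exists>a\<in>M. \<forall>b\<in>M. h b \<le> h a"
  proof (rule ccontr)
    assume "\<not> ?thesis"
    then have "M \<subseteq> \<Union>(B ` M)"
      using compactin_subset_topspace[OF comp] by (fastforce simp: B_def not_le)
    moreover have "openin T U" if "U \<in> B ` M" for U
      using usc that by (auto simp: upper_semicontinuous_map_def B_def)
    ultimately obtain \<F> where "finite \<F>" "\<F> \<subseteq> B ` M" "M \<subseteq> \<Union>\<F>"
      using comp unfolding compactin_def by meson
    then obtain N where N: "finite N" "N \<subseteq> M" "M \<subseteq> \<Union>(B ` N)"
      by (metis finite_subset_image)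
    with ne have "N \<noteq> {}" by auto
    then have "Max (h ` N) \<in> h ` N" using N(1) by simp
    then obtain a where a: "a \<in> N" "h a = Max (h ` N)" by auto
    then obtain b where "b \<in> N" "h a < h b"
      using N by (auto simp: B_def)
    moreover have "h b \<le> Max (h ` N)" using N(1) \<open>b \<in> N\<close> by simp
    ultimately show False using a(2) by linarith
  qed
  then show thesis using that by blast
qed

text \<open>Take \<open>v n\<close> to be a point of \<open>K n\<close> nearest to \<open>u\<close>;
  its distance to \<open>u\<close> is \<open>infdist u (K n)\<close>, which the Hausdorff distance
  bounds.\<close>

lemma hausdorff_limit_approx:
  fixes K :: "nat \<Rightarrow> 'a::{real_normed_vector,heine_borel} set"
  assumes "\<And>n. compact (K n)" "\<And>n. K n \<noteq> {}" "compact L"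
    and lim: "(\<lambda>n. hausdorff_metric (K n) L) \<longlonglongrightarrow> 0" and "u \<in> L"
  obtains v where "\<And>n. v n \<in> K n" "v \<longlonglongrightarrow> u"
proof -
  have "\<exists>y. y \<in> K n \<and> infdist u (K n) = dist u y" for n
    using infdist_attains_inf[of "K n" u] assms compact_imp_closed by metis
  then obtain v where v: "\<And>n. v n \<in> K n" "\<And>n. infdist u (K n) = dist u (v n)" by metis
  have "L \<noteq> {}" using assms by blast
  then have "dist (v n) u \<le> hausdorff_metric (K n) L" for n
    using infdist_le_hausdorff_dist[of L "K n" u] assms v(2)[of n]
    by (simp add: compact_imp_bounded hausdorff_metric_def dist_commute hausdorff_dist_commute)
  then have "(\<lambda>n. dist (v n) u) \<longlonglongrightarrow> 0"
    by (intro tendsto_sandwich[OF _ _ tendsto_const lim]) auto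
  then show thesis using that v(1) tendsto_dist_iff by blast
qed

lemma hausdorff_limit_mem:
  fixes K :: "nat \<Rightarrow> 'a::real_normed_vector set"
  assumes "\<And>n. compact (K n)" "\<And>n. a \<in> K n" "compact L"
    and lim: "(\<lambda>n. hausdorff_metric (K n) L) \<longlonglongrightarrow> 0"
  shows "a \<in> L"
proof -
  have ne: "K n \<noteq> {}" for n using assms(2) by blast
  \<comment> \<open>This has to be settled first, since \<open>infdist a {}\<close> is 0 by
    convention and says nothing about membership. An empty \<open>L\<close> would keep distance at
    least 1 from every \<open>K n\<close>.\<close>
  have "L \<noteq> {}"
  proof
    assume "L = {}"
    then have "(1::real) \<le> 0"
      using ne hausdorff_metric_empty_ge_1 by (intro LIMSEQ_le_const[OF lim]) blast
    then show False by simp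
  qed
  then have "infdist a L \<le> hausdorff_metric (K n) L" for n
    using infdist_le_hausdorff_dist[of "K n" L a] assms ne
    by (simp add: compact_imp_bounded hausdorff_metric_def)
  then have "infdist a L \<le> 0"
    by (intro LIMSEQ_le_const[OF lim]) blast
  then show ?thesis
    using in_closed_iff_infdist_zero[of L a] \<open>L \<noteq> {}\<close> \<open>compact L\<close> compact_imp_closed
      infdist_nonneg[of a L] by (metis order_antisym)
qed

text \<open>Each \<open>u\<close> in \<open>L\<close> is a limit of points \<open>v n\<close> of
  \<open>K n\<close>, so joint continuity carries the bound on \<open>h (x n, v n)\<close> over to
  the limit, although both arguments vary.\<close>

lemma hausdorff_limit_le:
  fixes K :: "nat \<Rightarrow> 'b::{real_normed_vector,heine_borel} set"
    and h :: "'a::topological_space \<times> 'b \<Rightarrow> real"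
  assumes cont: "continuous_on (X \<times> C) h"
    and x: "\<And>n. x n \<in> X" "x \<longlonglongrightarrow> x\<^sub>0" "x\<^sub>0 \<in> X"
    and K: "\<And>n. compact (K n)" "\<And>n. K n \<noteq> {}" "\<And>n. K n \<subseteq> C"
    and L: "compact L" "L \<subseteq> C" "(\<lambda>n. hausdorff_metric (K n) L) \<longlonglongrightarrow> 0"
    and le: "\<And>n u. u \<in> K n \<Longrightarrow> h (x n, u) \<le> c" and "u \<in> L"
  shows "h (x\<^sub>0, u) \<le> c"
proof -
  obtain v where v: "\<And>n. v n \<in> K n" "v \<longlonglongrightarrow> u"
    using hausdorff_limit_approx[OF K(1,2) L(1,3) \<open>u \<in> L\<close>] by metis
  have "(\<lambda>n. h (x n, v n)) \<longlonglongrightarrow> h (x\<^sub>0, u)"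
    using x K(3) v L(2) \<open>u \<in> L\<close>
    by (intro continuous_on_tendsto_compose[OF cont tendsto_Pair]) (auto intro!: always_eventually)
  then show ?thesis
    using le v(1) by (intro LIMSEQ_le_const2) blast+
qed

lemma le_on_closure:
  fixes h :: "'a::topological_space \<times> 'b::topological_space \<Rightarrow> real"
  assumes "continuous_on (X \<times> C) h" "x \<in> X" "closure W \<subseteq> C"
    and "\<And>u. u \<in> W \<Longrightarrow> h (x, u) \<le> c" and "u \<in> closure W"
  shows "h (x, u) \<le> c"
proof (rule continuous_le_on_closure[where f = "\<lambda>u. h (x, u)"])
  show "continuous_on (closure W) (\<lambda>u. h (x, u))"
    by (rule continuous_on_compose2[OF assms(1)]) (use assms in \<open>auto intro!: continuous_intros\<close>)
qed (use assms in auto)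

text \<open>Sequential closedness: the witnesses \<open>x n\<close> of a convergent sequence
  \<open>K n\<close> have a cluster point in the compact set \<open>X\<close>, and this point is a
  witness for the limit \<open>L\<close>.\<close>

lemma closedin_feasible_sets:
  fixes X :: "'a::metric_space set" and C :: "'b::{real_normed_vector,heine_borel} set"
    and f g :: "'a \<times> 'b \<Rightarrow> real"
  assumes "compact X" and f: "continuous_on (X \<times> C) f" and g: "continuous_on (X \<times> C) g"
    and sub: "\<S> \<subseteq> compact_subsets C"
  shows "closedin (Metric_space.mtopology \<S> hausdorff_metric)
           {W \<in> \<S>. ub \<in> W \<and> (\<exists>x\<in>X. \<forall>u\<in>W. f (x, u) \<le> c \<and> g (x, u) \<le> d)}" (is "closedin _ ?M")
proof -
  have S: "compact K" "K \<subseteq> C" if "K \<in> \<S>" for K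
    using sub that by (auto simp: compact_subsets_def)
  interpret Metric_space \<S> hausdorff_metric
    using Metric_space_hausdorff_subset S by blast
  have "L \<in> ?M" if K: "range K \<subseteq> ?M" and lim: "limitin mtopology K L sequentially" for K L
  proof -
    have KM: "K n \<in> ?M" for n using K by blast
    then obtain x where x: "\<And>n. x n \<in> X"
        "\<And>n u. u \<in> K n \<Longrightarrow> f (x n, u) \<le> c" "\<And>n u. u \<in> K n \<Longrightarrow> g (x n, u) \<le> d"
      by simp metis
    have K': "compact (K n)" "K n \<subseteq> C" "ub \<in> K n" "K n \<noteq> {}" for n
      using KM[of n] S by auto
    have L: "L \<in> \<S>" "(\<lambda>n. hausdorff_metric (K n) L) \<longlonglongrightarrow> 0"
      using lim by (auto simp: limitin_metric_dist_null)
    \<comment> \<open>The subsequence is chosen before either constraint is considered, so that the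
      same \<open>x\<^sub>0\<close> serves both \<open>f\<close> and \<open>g\<close>.\<close>
    obtain x\<^sub>0 r where r: "x\<^sub>0 \<in> X" "strict_mono r" "(x \<circ> r) \<longlonglongrightarrow> x\<^sub>0"
      using \<open>compact X\<close> x(1) unfolding compact_def by metis
    have Lr: "(\<lambda>n. hausdorff_metric ((K \<circ> r) n) L) \<longlonglongrightarrow> 0"
      using LIMSEQ_subseq_LIMSEQ[OF L(2) r(2)] by (simp add: o_def)
    have limit_le: "\<forall>u\<in>L. h (x\<^sub>0, u) \<le> b"
      if "continuous_on (X \<times> C) h" and le: "\<And>n u. u \<in> K n \<Longrightarrow> h (x n, u) \<le> b"
      for h :: "'a \<times> 'b \<Rightarrow> real" and b
    proof
      fix u
      assume "u \<in> L"
      show "h (x\<^sub>0, u) \<le> b"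
        by (rule hausdorff_limit_le[where x = "x \<circ> r" and K = "K \<circ> r",
              OF that(1) _ r(3,1) _ _ _ S[OF L(1)] Lr _ \<open>u \<in> L\<close>])
          (simp_all add: x(1) K' le)
    qed
    have "ub \<in> L"
      using hausdorff_limit_mem[OF K'(1,3) S(1)[OF L(1)] L(2)] .
    then show ?thesis
      using L(1) r(1) limit_le[OF f x(2)] limit_le[OF g x(3)] by blast
  qed
  then show ?thesis
    unfolding metric_closedin_iff_sequentially_closed by blast
qed

theorem theorem2p3:
  fixes X :: "(real ^ 'n) set"
    and \<U> :: "(real ^ 'm) set"
    and f g :: "(real ^ 'n) \<times> (real ^ 'm) \<Rightarrow> real"
    and \<W> :: "(real ^ 'm) set set"
    and V :: "(real ^ 'm) set \<Rightarrow> real"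
    and ub :: "real ^ 'm"
    and \<epsilon> :: real
  assumes "compact \<U>"
    and "compact X"
    and "continuous_on (X \<times> \<U>) f"
    and "continuous_on (X \<times> \<U>) g"
    and "ub \<in> \<U>"
    and "nominal_feasible X g ub \<noteq> {}"
    and "\<exists>x. is_arg_min (\<lambda>x. f (x, ub)) (\<lambda>x. x \<in> nominal_feasible X g ub) x"
    and "\<epsilon> \<ge> 0"
    and "\<W> \<subseteq> Pow \<U>"
    and A1: "\<And>W. W \<in> \<W> \<Longrightarrow> closure W \<in> \<W>"
    and A2: "\<And>C. compact C \<Longrightarrow> C \<subseteq> \<U> \<Longrightarrow>
               Metric_space.mcomplete (compact_subsets C \<inter> \<W>) hausdorff_metric"
    and A3: "{ub} \<in> \<W>"
    and B1: "upper_semicontinuous_map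
               (Metric_space.mtopology (compact_subsets \<U> \<inter> \<W>) hausdorff_metric) V"
    and B2: "\<And>W\<^sub>1 W\<^sub>2. W\<^sub>1 \<in> \<W> \<Longrightarrow> W\<^sub>2 \<in> \<W> \<Longrightarrow> W\<^sub>1 \<subseteq> W\<^sub>2 \<Longrightarrow> V W\<^sub>1 \<le> V W\<^sub>2"
  shows "\<exists>x\<^sub>0 W\<^sub>0. irop_maximizer X \<W> V f g ub \<epsilon> (x\<^sub>0, W\<^sub>0) \<and> compact W\<^sub>0"
proof -
  define c where "c = nominal_value X f g ub + \<epsilon>"
  define \<S> where "\<S> = compact_subsets \<U> \<inter> \<W>"
  \<comment> \<open>Since \<open>V\<close> depends on \<open>W\<close> alone, \<open>x\<close> is
    hidden behind an existential quantifier and the maximization takes place over sets only.\<close>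
  define M where "M = {W \<in> \<S>. ub \<in> W \<and> (\<exists>x\<in>X. \<forall>u\<in>W. f (x, u) \<le> c \<and> g (x, u) \<le> 0)}"
  have sub: "\<S> \<subseteq> compact_subsets \<U>" by (simp add: \<S>_def)
  have "compactin (Metric_space.mtopology \<S> hausdorff_metric) M"
    unfolding M_def
    using closedin_feasible_sets[OF \<open>compact X\<close> assms(3,4) sub]
      compact_space_hausdorff[OF \<open>compact \<U>\<close> sub] A2[OF \<open>compact \<U>\<close> order_refl]
    by (intro closedin_compact_space) (auto simp: \<S>_def)
  moreover have "M \<noteq> {}"
  proof -
    obtain x where x: "x \<in> nominal_feasible X g ub"
        "\<And>y. y \<in> nominal_feasible X g ub \<Longrightarrow> f (x, ub) \<le> f (y, ub)"
      using assms(7) by (auto simp: is_arg_min_linorder)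
    \<comment> \<open>A nominal minimizer \<open>x\<close> is a witness for \<open>{ub}\<close>: its
      value is at most the infimum, hence at most \<open>c\<close> because \<open>\<epsilon>\<close>
      is nonnegative.\<close>
    have "f (x, ub) \<le> nominal_value X f g ub"
      unfolding nominal_value_def using x by (intro cINF_greatest) auto
    then have "{ub} \<in> M"
      using x(1) A3 assms(5,8)
      by (auto simp: M_def \<S>_def c_def compact_subsets_def nominal_feasible_def intro!: bexI[of _ x])
    then show ?thesis by blast
  qed
  ultimately obtain W\<^sub>0 where W0: "W\<^sub>0 \<in> M" "\<And>W. W \<in> M \<Longrightarrow> V W \<le> V W\<^sub>0"
    using upper_semicontinuous_map_attains_max B1 unfolding \<S>_def by blast
  then obtain x\<^sub>0 where x0: "x\<^sub>0 \<in> X" "\<forall>u\<in>W\<^sub>0. f (x\<^sub>0, u) \<le> c \<and> g (x\<^sub>0, u) \<le> 0"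
    by (auto simp: M_def)
  have "V W \<le> V W\<^sub>0" if "(x, W) \<in> irop_feasible X \<W> f g ub \<epsilon>" for x W
  proof -
    have W: "x \<in> X" "W \<in> \<W>" "ub \<in> W" "\<And>u. u \<in> W \<Longrightarrow> f (x, u) \<le> c" "\<And>u. u \<in> W \<Longrightarrow> g (x, u) \<le> 0"
      using that by (auto simp: irop_feasible_def c_def)
    \<comment> \<open>The closure must stay inside \<open>\<U>\<close>, because \<open>f\<close> and
      \<open>g\<close> are continuous only over \<open>X \<times> \<U>\<close>; this also makes it
      compact.\<close>
    have clU: "closure W \<subseteq> \<U>"
      using W(2) \<open>\<W> \<subseteq> Pow \<U>\<close> \<open>compact \<U>\<close> by (intro closure_minimal compact_imp_closed) auto
    then have "compact (closure W)"
      using compact_Int_closed[OF \<open>compact \<U>\<close> closed_closure] by (metis inf.absorb2)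
    moreover have "\<forall>u\<in>closure W. f (x, u) \<le> c \<and> g (x, u) \<le> 0"
      using le_on_closure[OF assms(3) W(1) clU W(4)] le_on_closure[OF assms(4) W(1) clU W(5)]
      by blast
    moreover have "ub \<in> closure W" using W(3) closure_subset by blast
    ultimately have "closure W \<in> M"
      using clU A1[OF W(2)] W(1) by (auto simp: M_def \<S>_def compact_subsets_def)
    then show ?thesis
      using W0(2) B2[OF W(2) A1[OF W(2)] closure_subset] by fastforce
  qed
  moreover have "(x\<^sub>0, W\<^sub>0) \<in> irop_feasible X \<W> f g ub \<epsilon>" "compact W\<^sub>0"
    using W0(1) x0 by (auto simp: M_def \<S>_def irop_feasible_def c_def compact_subsets_def)
  ultimately show ?thesis
    unfolding irop_maximizer_def is_arg_max_linorder by auto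
qed

end
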